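(* For any constant integer $d\ge1$, there exists a probability distribution $\mu_{\infty,d}$ on $\mathrm{Hom}(P_{\infty,d},0)$ such that the uniform distribution on $\mathrm{Hom}(P_{n,d},0)$ converges to $\mu_{\infty,d}$ as $n\to\infty$ in the following sense: if $f_{n,d}$ is uniformly chosen from $\mathrm{Hom}(P_{n,d},0)$ and $f_{\infty,d}$ is sampled from $\mu_{\infty,d}$, then $$\mathbb{P}\big(f_{n,d}|_{\{0,1,\dots,r\}}=f\big)\xrightarrow[n\to\infty]{}\mathbb{P}\big(f_{\infty,d}|_{\{0,1,\dots,r\}}=f\big)\quad\text{for any integer }r\ge0\text{ and any }f\in\mathbb{Z}^{\{0,1,\dots,r\}}.$$
   Context: For $n,d\ge1$, $P_{n,d}$ is the graph with vertex set $\{0,1,\dots,n\}$ in which $i,j$ are adjacent iff $|i-j|\in\{1,3,\dots,2d+1\}$, and $P_{\infty,d}$ is the graph with vertex set $\{0,1,2,\dots\}$ and the same adjacency rule. For $G\in\{P_{n,d},P_{\infty,d}\}$, $\mathrm{Hom}(G,0)$ is the set of functions $f\colon V(G)\to\mathbb{Z}$ with $f(0)=0$ and $|f(i)-f(j)|=1$ whenever $i,j$ are adjacent in $G$. $g|_A$ denotes the restriction of a function $g$ to a subset $A$ of its domain. *)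

theory Defs
  imports "HOL-Probability.Probability"
begin

definition P_adj :: "nat \<Rightarrow> nat \<Rightarrow> nat \<Rightarrow> bool" where
  "P_adj d i j \<longleftrightarrow> \<bar>int i - int j\<bar> \<in> {2 * int k + 1 | k. k \<le> d}"

text \<open>
  Functions on the vertex set \<open>V\<close> are represented by extensional functions, so that
  distinct elements of \<open>Hom0\<close> are distinct as functions on \<open>V\<close>.
\<close>

definition Hom0 :: "nat set \<Rightarrow> (nat \<Rightarrow> nat \<Rightarrow> bool) \<Rightarrow> (nat \<Rightarrow> int) set" where
  "Hom0 V adj =
     {f \<in> V \<rightarrow>\<^sub>E UNIV. f 0 = 0 \<and> (\<forall>i\<in>V. \<forall>j\<in>V. adj i j \<longrightarrow> \<bar>f i - f j\<bar> = 1)}"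

definition Hom_P :: "nat \<Rightarrow> nat \<Rightarrow> (nat \<Rightarrow> int) set" where
  "Hom_P n d = Hom0 {0..n} (P_adj d)"

definition Hom_P_inf :: "nat \<Rightarrow> (nat \<Rightarrow> int) set" where
  "Hom_P_inf d = Hom0 UNIV (P_adj d)"

text \<open>
  \<open>Hom_P_inf d\<close> is uncountable; it carries the trace of the product sigma-algebra on
  \<open>nat \<Rightarrow> int\<close>, i.e. the one generated by the values at the individual vertices.
\<close>

definition Hom_P_inf_space :: "nat \<Rightarrow> (nat \<Rightarrow> int) measure" where
  "Hom_P_inf_space d =
     restrict_space (\<Pi>\<^sub>M i\<in>UNIV. count_space UNIV) (Hom_P_inf d)"

lemma space_Hom_P_inf_space: "space (Hom_P_inf_space d) = Hom_P_inf d"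
  by (auto simp: Hom_P_inf_space_def space_restrict_space space_PiM)

lemma sets_Hom_P_inf_space_restrict_eq:
  "{g \<in> space (Hom_P_inf_space d). restrict g {0..r} = f} \<in> sets (Hom_P_inf_space d)"
proof (cases "f \<in> extensional {0..r}")
  case True
  have coord [measurable]: "(\<lambda>g. g i) \<in> measurable (Hom_P_inf_space d) (count_space UNIV)" for i
    unfolding Hom_P_inf_space_def by (intro measurable_restrict_space1 measurable_component_singleton) simp
  have "{g \<in> space (Hom_P_inf_space d). restrict g {0..r} = f}
      = {g \<in> space (Hom_P_inf_space d). \<forall>i\<in>{0..r}. g i = f i}"
    using True by (auto simp: fun_eq_iff restrict_def extensional_def)
  also have "\<dots> \<in> sets (Hom_P_inf_space d)"
    by measurable
  finally show ?thesis .
next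
  case False
  then have "{g \<in> space (Hom_P_inf_space d). restrict g {0..r} = f} = {}"
    using restrict_extensional by blast
  then show ?thesis by (simp only: sets.empty_sets)
qed

text \<open>
  \<open>pmf_of_set\<close> is the uniform distribution only on finite nonempty sets.
\<close>

lemma Hom_P_nonempty: "Hom_P n d \<noteq> {}"
proof -
  have "\<bar>int (i mod 2) - int (j mod 2)\<bar> = 1" if "P_adj d i j" for i j :: nat
  proof -
    from that obtain k where "\<bar>int i - int j\<bar> = 2 * int k + 1"
      by (auto simp: P_adj_def)
    then show ?thesis by presburger
  qed
  then have "restrict (\<lambda>i. int (i mod 2)) {0..n} \<in> Hom_P n d"
    by (auto simp: Hom_P_def Hom0_def)
  then show ?thesis by blast
qed

lemma finite_Hom_P: "finite (Hom_P n d)"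
proof (rule finite_subset)
  show "Hom_P n d \<subseteq> {0..n} \<rightarrow>\<^sub>E {- int n..int n}"
  proof
    fix f assume f: "f \<in> Hom_P n d"
    have step: "\<bar>f i - f (Suc i)\<bar> = 1" if "Suc i \<le> n" for i
    proof -
      have "P_adj d i (Suc i)"
        by (auto simp: P_adj_def intro!: exI[of _ 0])
      then show ?thesis using f that by (auto simp: Hom_P_def Hom0_def)
    qed
    have "\<bar>f i\<bar> \<le> int i" if "i \<le> n" for i
      using that
    proof (induction i)
      case 0
      then show ?case using f by (simp add: Hom_P_def Hom0_def)
    next
      case (Suc i)
      then show ?case using step[of i] by auto
    qed
    then have "f i \<in> {- int n..int n}" if "i \<le> n" for i
      using that by (force simp: abs_le_iff)
    then show "f \<in> {0..n} \<rightarrow>\<^sub>E {- int n..int n}"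
      using f by (auto simp: Hom_P_def Hom0_def PiE_def)
  qed
qed (auto intro: finite_PiE)

end

theory Submission
  imports Defs
begin

text \<open>
  A homomorphism is determined by its increments, and these form a language of words over
  \<open>{1, -1}\<close> in which membership is decided by factors of length at most \<open>2 * d + 1\<close>.  Alternating
  words can be appended to any word of the language, and any two alternating words can be
  juxtaposed, so any two words of the language are joined by a connecting word of length
  \<open>4 * d\<close>.  Group the words of length \<open>n\<close> by their last \<open>2 * d\<close> letters and consider in each
  group the fraction of words with a given prefix.  As \<open>n\<close> grows these fractions are replaced
  by weighted averages of one another, and by the connecting words the averaging contracts
  their range by a fixed factor; hence the prefix frequencies converge.  The limits form a
  consistent family of distributions, to which Kolmogorov's extension theorem applies.
\<close>

section \<open>Prefix frequencies in languages of finite type\<close>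

text \<open>The language of a mixing subshift of finite type. By \<open>factor\<close> and
  \<open>glue\<close>, a memory of \<open>B\<close> letters decides how a word may continue; in
  \<open>connect\<close> the gap \<open>G\<close> does not depend on the two words.\<close>

locale finite_type_language =
  fixes L :: "'a list set" and A :: "'a set" and B G :: nat
  assumes finite_alphabet: "finite A" and L_lists: "L \<subseteq> lists A"
    and words_exist: "\<exists>ws\<in>L. length ws = n"
    and factor: "us @ ws @ vs \<in> L \<Longrightarrow> ws \<in> L"
    and glue: "us @ ws \<in> L \<Longrightarrow> ws @ vs \<in> L \<Longrightarrow> B \<le> length ws \<Longrightarrow> us @ ws @ vs \<in> L"
    and connect: "us \<in> L \<Longrightarrow> vs \<in> L \<Longrightarrow> \<exists>ws. length ws = G \<and> us @ ws @ vs \<in> L"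
begin

definition words :: "nat \<Rightarrow> 'a list set" where
  "words n = {ws \<in> L. length ws = n}"

definition cyl :: "'a list \<Rightarrow> nat \<Rightarrow> 'a list set" where
  "cyl u n = {ws \<in> words n. take (length u) ws = u}"

text \<open>For \<open>B \<le> n\<close> the end block is the state of a transfer matrix: by
  \<open>glue\<close> it alone decides which continuations stay in \<open>L\<close>.\<close>

definition cyl_end :: "'a list \<Rightarrow> nat \<Rightarrow> 'a list \<Rightarrow> 'a list set" where
  "cyl_end u n s = {ws \<in> cyl u n. drop (n - B) ws = s}"

text \<open>For blocks \<open>t\<close> and \<open>s\<close> of length \<open>B\<close>, the size of
  this set is the entry at \<open>(t, s)\<close> of the \<open>j\<close>-th power of the transfer
  matrix.\<close>

definition steps :: "nat \<Rightarrow> 'a list \<Rightarrow> 'a list \<Rightarrow> 'a list set" where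
  "steps j t s = {vs. length vs = j \<and> t @ vs \<in> L \<and> drop j (t @ vs) = s}"

lemma words_eq_cyl: "words n = cyl [] n"
  by (simp add: cyl_def)

lemma finite_lists_alphabet: "finite {ws. set ws \<subseteq> A \<and> length ws = n}"
  using finite_alphabet by (rule finite_lists_length_eq)

lemma words_subset: "words n \<subseteq> {ws. set ws \<subseteq> A \<and> length ws = n}"
  using L_lists by (auto simp: words_def lists_eq_set)

lemma finite_words: "finite (words n)"
  using finite_subset[OF words_subset finite_lists_alphabet] .

lemma finite_cyl: "finite (cyl u n)"
  using finite_words by (simp add: cyl_def)

lemma finite_cyl_end: "finite (cyl_end u n s)"
  using finite_cyl by (simp add: cyl_end_def)

lemma words_nonempty: "words n \<noteq> {}"
  using words_exist[of n] by (auto simp: words_def)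

lemma prefix_in: "us @ vs \<in> L \<Longrightarrow> us \<in> L"
  using factor[of "[]" us vs] by simp

lemma suffix_in: "us @ vs \<in> L \<Longrightarrow> vs \<in> L"
  using factor[of us vs "[]"] by simp

lemma steps_subset: "steps j t s \<subseteq> {ws. set ws \<subseteq> A \<and> length ws = j}"
  using L_lists by (auto simp: steps_def lists_eq_set dest!: suffix_in)

lemma finite_steps: "finite (steps j t s)"
  using finite_subset[OF steps_subset finite_lists_alphabet] .

lemma card_steps_le: "card (steps j t s) \<le> card A ^ j"
  using card_mono[OF finite_lists_alphabet steps_subset]
  by (simp add: card_lists_length_eq[OF finite_alphabet])

text \<open>\<open>connect\<close> contributes \<open>G\<close> letters, the block \<open>s\<close>
  itself the other \<open>B\<close>.\<close>

lemma card_steps_ge: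
  assumes "t \<in> words B" "s \<in> words B"
  shows "1 \<le> card (steps (G + B) t s)"
proof -
  obtain ws where "length ws = G" "t @ ws @ s \<in> L"
    using connect[of t s] assms by (auto simp: words_def)
  then have "ws @ s \<in> steps (G + B) t s"
    using assms by (auto simp: steps_def words_def)
  then show ?thesis
    using finite_steps by (metis One_nat_def Suc_leI card_gt_0_iff empty_iff)
qed

section \<open>Counting words by their end block\<close>

lemma card_cyl_split:
  assumes "B \<le> n"
  shows "card (cyl u n) = (\<Sum>s\<in>words B. card (cyl_end u n s))"
proof -
  have "drop (n - B) ws \<in> words B" if "ws \<in> cyl u n" for ws
    using that assms suffix_in[of "take (n - B) ws" "drop (n - B) ws"]
    by (auto simp: words_def cyl_def)
  then have "cyl u n = (\<Union>s\<in>words B. cyl_end u n s)"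
    by (auto simp: cyl_end_def)
  also have "card \<dots> = (\<Sum>s\<in>words B. card (cyl_end u n s))"
    by (rule card_UN_disjoint) (auto simp: finite_words finite_cyl_end, auto simp: cyl_end_def)
  finally show ?thesis .
qed

text \<open>Cutting a word after \<open>n\<close> letters gives a beginning with end block
  \<open>t\<close> and a continuation of \<open>t\<close>; conversely \<open>glue\<close> joins any
  such pair along \<open>t\<close>. As \<open>length u \<le> n\<close>, the prefix condition
  concerns the beginning only.\<close>

lemma card_cyl_end_add:
  assumes "B \<le> n" "length u \<le> n"
  shows "card (cyl_end u (n + j) s)
    = (\<Sum>t\<in>words B. card (cyl_end u n t) * card (steps j t s))"
proof -
  let ?S = "SIGMA t:words B. cyl_end u n t \<times> steps j t s"
  have "bij_betw (\<lambda>(t, g, v). g @ v) ?S (cyl_end u (n + j) s)"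
  proof (rule bij_betw_byWitness[where f' = "\<lambda>h. (drop (n - B) (take n h), take n h, drop n h)"])
    show "\<forall>a\<in>?S. (\<lambda>h. (drop (n - B) (take n h), take n h, drop n h)) ((\<lambda>(t, g, v). g @ v) a) = a"
      by (auto simp: cyl_end_def cyl_def words_def)
    show "\<forall>h\<in>cyl_end u (n + j) s.
        (\<lambda>(t, g, v). g @ v) (drop (n - B) (take n h), take n h, drop n h) = h"
      by auto
    show "(\<lambda>(t, g, v). g @ v) ` ?S \<subseteq> cyl_end u (n + j) s"
    proof clarsimp
      fix t g v
      assume t: "t \<in> words B" and g: "g \<in> cyl_end u n t" and v: "v \<in> steps j t s"
      define g0 where "g0 = take (n - B) g"
      have "drop (n - B) g = t"
        using g by (simp add: cyl_end_def)
      then have gt: "g = g0 @ t"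
        unfolding g0_def by (metis append_take_drop_id)
      have len: "length g = n" "length g0 = n - B" "length t = B"
        and gL: "g \<in> L"
        using g t by (auto simp: g0_def cyl_end_def cyl_def words_def)
      have "g @ v \<in> L"
        using glue[of g0 t v] gL v len by (simp add: gt steps_def)
      moreover have "drop (n + j - B) (g @ v) = s"
      proof -
        \<comment> \<open>Of the \<open>n + j - B\<close> dropped letters, \<open>n - B\<close>
          exhaust \<open>g0\<close>, which leaves \<open>j\<close> to be dropped from
          \<open>t @ v\<close>.\<close>
        have "drop (n + j - B) (g @ v) = drop (n - B + j) (g0 @ t @ v)"
          using assms by (simp add: gt)
        also have "\<dots> = drop j (t @ v)" using len by simp
        finally show ?thesis using v by (simp add: steps_def)
      qed
      ultimately show "g @ v \<in> cyl_end u (n + j) s"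
        using g v assms by (auto simp: cyl_end_def cyl_def words_def steps_def)
    qed
    show "(\<lambda>h. (drop (n - B) (take n h), take n h, drop n h)) ` cyl_end u (n + j) s \<subseteq> ?S"
    proof (rule image_subsetI)
      fix h assume h: "h \<in> cyl_end u (n + j) s"
      have hL: "h \<in> L" and len: "length h = n + j" and pre: "take (length u) h = u"
        and suf: "drop (n + j - B) h = s"
        using h by (auto simp: cyl_end_def cyl_def words_def)
      define t where "t = drop (n - B) (take n h)"
      have take_n: "take n h = take (n - B) h @ t"
        using append_take_drop_id[of "n - B" "take n h"] by (simp only: t_def take_take min_def) simp
      have drop_B: "drop (n - B) h = t @ drop n h"
        using assms len by (subst append_take_drop_id[of n h, symmetric], subst take_n) simp
      have tn: "take n h \<in> L" using hL by (metis append_take_drop_id prefix_in)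
      have tL: "t \<in> L" using tn take_n suffix_in by metis
      have tv: "t @ drop n h \<in> L"
        unfolding drop_B[symmetric] using hL by (metis append_take_drop_id suffix_in)
      have lt: "length t = B" using len assms by (simp add: t_def)
      have "drop j (t @ drop n h) = drop (n - B + j) h"
        unfolding drop_B[symmetric] drop_drop by (simp only: add.commute)
      then have "drop j (t @ drop n h) = s" using suf assms by simp
      then show "(drop (n - B) (take n h), take n h, drop n h) \<in> ?S"
        using tn tL tv lt len pre assms
        by (auto simp: t_def[symmetric] words_def cyl_end_def cyl_def steps_def min_def)
    qed
  qed
  then have "card (cyl_end u (n + j) s) = card ?S"
    by (simp add: bij_betw_same_card)
  also have "\<dots> = (\<Sum>t\<in>words B. card (cyl_end u n t) * card (steps j t s))"
    by (simp add: card_SigmaI finite_words finite_cyl_end finite_steps card_cartesian_product)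
  finally show ?thesis .
qed

text \<open>Bounds the conditional frequency of the prefix \<open>u\<close> given the end block, for
  all blocks at once. In this multiplied-out form, an end block that no word of length
  \<open>n\<close> has imposes nothing.\<close>

definition between :: "'a list \<Rightarrow> nat \<Rightarrow> real \<Rightarrow> real \<Rightarrow> bool" where
  "between u n l h \<longleftrightarrow> (\<forall>s\<in>words B.
     l * real (card (cyl_end [] n s)) \<le> real (card (cyl_end u n s)) \<and>
     real (card (cyl_end u n s)) \<le> h * real (card (cyl_end [] n s)))"

definition freq :: "'a list \<Rightarrow> nat \<Rightarrow> real" where
  "freq u n = card (cyl u n) / card (words n)"

lemma between_0_1: "between u n 0 1"
  unfolding between_def
  by (auto intro!: card_mono finite_cyl_end) (auto simp: cyl_end_def cyl_def)

text \<open>By \<open>card_cyl_end_add\<close> the later counts, with and without the prefix,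
  combine the earlier ones with the same nonnegative weights, so the bounds persist.\<close>

lemma between_add:
  assumes "between u n l h" "B \<le> n" "length u \<le> n"
  shows "between u (n + j) l h"
  using assms(1) unfolding between_def
  by (auto simp: card_cyl_end_add assms sum_distrib_left mult.assoc[symmetric]
      intro!: sum_mono mult_right_mono)

text \<open>The overall frequency is a weighted average of the conditional ones.\<close>

lemma freq_between:
  assumes "between u n l h" "B \<le> n"
  shows "l \<le> freq u n" "freq u n \<le> h"
proof -
  have pos: "0 < card (words n)"
    using finite_words words_nonempty by (simp add: card_gt_0_iff)
  have "l * real (card (words n)) \<le> real (card (cyl u n))"
    "real (card (cyl u n)) \<le> h * real (card (words n))"
    using assms unfolding between_def
    by (auto simp: words_eq_cyl[of n] card_cyl_split sum_distrib_left intro!: sum_mono)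
  then show "l \<le> freq u n" "freq u n \<le> h"
    using pos by (auto simp: freq_def field_simps)
qed

text \<open>
  After \<open>G + B\<close> further letters each pair of end blocks is joined by between \<open>1\<close> and
  \<open>card A ^ (G + B)\<close> words, so a fixed fraction of every conditional frequency is the
  overall frequency at time \<open>n\<close>, as in Doeblin's minorization argument.
\<close>

lemma between_contract:
  assumes bt: "between u n l h" and n: "B \<le> n" "length u \<le> n"
  defines "q \<equiv> 1 / real (card A ^ (G + B))"
  shows "between u (n + (G + B)) (l + q * (freq u n - l)) (h - q * (h - freq u n))"
proof -
  let ?K = "G + B"
  define x where "x t = real (card (cyl_end u n t))" for t
  define y where "y t = real (card (cyl_end [] n t))" for t
  define a where "a t s = real (card (steps ?K t s))" for t s
  define T where "T = (\<Sum>t\<in>words B. y t)"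
  define p where "p = freq u n"
  have cw: "real (card (words n)) = T"
    by (simp add: words_eq_cyl[of n] card_cyl_split n T_def y_def)
  have T0: "T > 0"
    using finite_words words_nonempty by (simp add: cw[symmetric] card_gt_0_iff)
  have X: "(\<Sum>t\<in>words B. x t) = p * T"
    using T0 by (simp add: p_def freq_def card_cyl_split[OF n(1)] x_def cw)
  have p: "l \<le> p" "p \<le> h" using freq_between[OF bt n(1)] by (auto simp: p_def)
  have lo: "l * y t \<le> x t" and hi: "x t \<le> h * y t" if "t \<in> words B" for t
    using bt that by (auto simp: between_def x_def y_def)
  have a1: "1 \<le> a t s" if "t \<in> words B" "s \<in> words B" for t s
    using card_steps_ge[OF that] by (simp add: a_def)
  show ?thesis
    unfolding between_def
  proof (intro ballI)
    fix s assume s: "s \<in> words B"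
    obtain t0 where t0: "t0 \<in> words B" using words_nonempty by auto
    have C: "0 < real (card A ^ ?K)"
      using card_steps_ge[OF t0 s] card_steps_le[of ?K t0 s] by linarith
    have x': "real (card (cyl_end u (n + ?K) s)) = (\<Sum>t\<in>words B. x t * a t s)"
      and y': "real (card (cyl_end [] (n + ?K) s)) = (\<Sum>t\<in>words B. y t * a t s)"
      by (simp_all add: card_cyl_end_add n x_def y_def a_def)
    \<comment> \<open>Two blocks are joined by at most \<open>card A ^ (G + B)\<close> words, so
      \<open>q\<close> times the later class of \<open>s\<close> is at most the number
      \<open>T\<close> of all words of length \<open>n\<close>.\<close>
    have "(\<Sum>t\<in>words B. y t * a t s) \<le> (\<Sum>t\<in>words B. y t * real (card A ^ ?K))"
      unfolding a_def y_def
      by (intro sum_mono mult_left_mono of_nat_mono card_steps_le) auto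
    then have yC: "q * (\<Sum>t\<in>words B. y t * a t s) \<le> T"
      using C by (simp add: q_def T_def sum_distrib_right[symmetric] field_simps)
    \<comment> \<open>The deviations from \<open>l\<close> are nonnegative, so raising each weight
      from 1 to \<open>a t s\<close> cannot lower the sum. The same is done for the deviations from
      \<open>h\<close> below.\<close>
    have "p * T - l * T = (\<Sum>t\<in>words B. (x t - l * y t) * 1)"
      by (simp add: sum_subtractf X sum_distrib_left[symmetric] T_def)
    also have "\<dots> \<le> (\<Sum>t\<in>words B. (x t - l * y t) * a t s)"
      using lo s by (intro sum_mono mult_left_mono a1) auto
    also have "\<dots> = (\<Sum>t\<in>words B. x t * a t s) - l * (\<Sum>t\<in>words B. y t * a t s)"
      by (simp add: sum_subtractf left_diff_distrib sum_distrib_left mult.assoc)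
    finally have 1: "(p - l) * T \<le> (\<Sum>t\<in>words B. x t * a t s) - l * (\<Sum>t\<in>words B. y t * a t s)"
      by (simp add: left_diff_distrib)
    have "h * T - p * T = (\<Sum>t\<in>words B. (h * y t - x t) * 1)"
      by (simp add: sum_subtractf X sum_distrib_left[symmetric] T_def)
    also have "\<dots> \<le> (\<Sum>t\<in>words B. (h * y t - x t) * a t s)"
      using hi s by (intro sum_mono mult_left_mono a1) auto
    also have "\<dots> = h * (\<Sum>t\<in>words B. y t * a t s) - (\<Sum>t\<in>words B. x t * a t s)"
      by (simp add: sum_subtractf left_diff_distrib sum_distrib_left mult.assoc)
    finally have 2: "(h - p) * T \<le> h * (\<Sum>t\<in>words B. y t * a t s) - (\<Sum>t\<in>words B. x t * a t s)"
      by (simp add: left_diff_distrib)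
    \<comment> \<open>As \<open>p - l\<close> and \<open>h - p\<close> are nonnegative, the bound on
      \<open>T\<close> turns both gains into multiples of the later class size.\<close>
    have 3: "(p - l) * (q * (\<Sum>t\<in>words B. y t * a t s)) \<le> (p - l) * T"
      "(h - p) * (q * (\<Sum>t\<in>words B. y t * a t s)) \<le> (h - p) * T"
      using yC p by (auto intro: mult_left_mono)
    show "(l + q * (freq u n - l)) * real (card (cyl_end [] (n + ?K) s))
        \<le> real (card (cyl_end u (n + ?K) s)) \<and>
      real (card (cyl_end u (n + ?K) s))
        \<le> (h - q * (h - freq u n)) * real (card (cyl_end [] (n + ?K) s))"
      unfolding x' y' p_def[symmetric]
      using 1 2 3 by (simp add: algebra_simps)
  qed
qed

text \<open>The gains \<open>q * (p - l)\<close> and \<open>q * (h - p)\<close> at the two ends,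
  with \<open>p\<close> the current frequency, add up to \<open>q * (h - l)\<close>. So each period
  of \<open>G + B\<close> letters shrinks the interval by the factor \<open>1 - q\<close>, and all
  later frequencies stay inside it: the sequence is Cauchy.\<close>

lemma freq_convergent: "convergent (freq u)"
proof -
  let ?K = "G + B"
  define q where "q = 1 / real (card A ^ ?K)"
  \<comment> \<open>The offset secures the two length conditions of \<open>between_contract\<close>;
    each index adds one contraction period.\<close>
  define m where "m i = length u + B + i * ?K" for i
  obtain s where s: "s \<in> words B" using words_nonempty by auto
  have C: "1 \<le> card A ^ ?K"
    using card_steps_ge[OF s s] card_steps_le[of ?K s s] by linarith
  have q: "0 < q" "q \<le> 1"
  proof -
    define c where "c = real (card A ^ ?K)"
    have "1 \<le> c" unfolding c_def using C by linarith
    then show "0 < q" "q \<le> 1" unfolding q_def c_def[symmetric] by auto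
  qed
  have ex: "\<exists>l h. between u (m i) l h \<and> h - l = (1 - q) ^ i" for i
  proof (induction i)
    case 0
    show ?case using between_0_1 by (intro exI[of _ 0] exI[of _ 1]) simp
  next
    case (Suc i)
    then obtain l h where lh: "between u (m i) l h" "h - l = (1 - q) ^ i" by blast
    have "between u (m i + ?K) (l + q * (freq u (m i) - l)) (h - q * (h - freq u (m i)))"
      unfolding q_def by (rule between_contract[OF lh(1)]) (auto simp: m_def)
    moreover have "(h - q * (h - freq u (m i))) - (l + q * (freq u (m i) - l)) = (1 - q) * (h - l)"
      by (simp add: algebra_simps)
    moreover have "m (Suc i) = m i + ?K" by (simp add: m_def)
    ultimately show ?case using lh(2) by (metis power_Suc)
  qed
  have "Cauchy (freq u)"
  proof (rule metric_CauchyI)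
    fix e :: real assume "e > 0"
    then obtain i where i: "(1 - q) ^ i < e"
      using real_arch_pow_inv[of e "1 - q"] q by auto
    obtain l h where lh: "between u (m i) l h" "h - l = (1 - q) ^ i" using ex by blast
    have *: "freq u n \<in> {l..h}" if "n \<ge> m i" for n
    proof -
      have "between u (m i + (n - m i)) l h"
        by (rule between_add[OF lh(1)]) (auto simp: m_def)
      then have "between u n l h" using that by simp
      moreover have "B \<le> n" using that by (simp add: m_def)
      ultimately show ?thesis using freq_between by auto
    qed
    have "dist (freq u n) (freq u n') < e" if "n \<ge> m i" "n' \<ge> m i" for n n'
      using *[OF that(1)] *[OF that(2)] lh(2) i by (auto simp: dist_real_def abs_if)
    then show "\<exists>M. \<forall>n\<ge>M. \<forall>n'\<ge>M. dist (freq u n) (freq u n') < e" by blast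
  qed
  then show ?thesis by (simp add: Cauchy_convergent_iff)
qed

end

section \<open>Limits and extensions of discrete distributions\<close>

lemma pmf_map_sum:
  assumes "finite S" "set_pmf p \<subseteq> S"
  shows "pmf (map_pmf h p) y = (\<Sum>x\<in>S \<inter> h -` {y}. pmf p x)"
proof -
  have "pmf (map_pmf h p) y = measure_pmf.prob p (h -` {y} \<inter> set_pmf p)"
    by (simp add: pmf_map measure_Int_set_pmf)
  also have "\<dots> = measure_pmf.prob p (S \<inter> h -` {y})"
    using assms(2) by (subst (2) measure_Int_set_pmf[symmetric]) (auto intro!: arg_cong[where f = "measure_pmf.prob p"])
  also have "\<dots> = (\<Sum>x\<in>S \<inter> h -` {y}. pmf p x)"
    using assms(1) by (simp add: measure_measure_pmf_finite)
  finally show ?thesis .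
qed

text \<open>On a common finite support an image probability is a finite sum, which commutes with the
  limit.\<close>

lemma tendsto_pmf_map:
  assumes S: "finite S" "\<forall>\<^sub>F n in F. set_pmf (Q n) \<subseteq> S" "set_pmf \<nu> \<subseteq> S"
    and lim: "\<And>x. ((\<lambda>n. pmf (Q n) x) \<longlongrightarrow> pmf \<nu> x) F"
  shows "((\<lambda>n. pmf (map_pmf h (Q n)) y) \<longlongrightarrow> pmf (map_pmf h \<nu>) y) F"
proof -
  have "((\<lambda>n. \<Sum>x\<in>S \<inter> h -` {y}. pmf (Q n) x) \<longlongrightarrow> (\<Sum>x\<in>S \<inter> h -` {y}. pmf \<nu> x)) F"
    by (intro tendsto_sum lim)
  also have "(\<Sum>x\<in>S \<inter> h -` {y}. pmf \<nu> x) = pmf (map_pmf h \<nu>) y"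
    by (rule pmf_map_sum[OF S(1,3), symmetric])
  finally have lim_sum:
    "((\<lambda>n. \<Sum>x\<in>S \<inter> h -` {y}. pmf (Q n) x) \<longlongrightarrow> pmf (map_pmf h \<nu>) y) F" .
  have "\<forall>\<^sub>F n in F. (\<Sum>x\<in>S \<inter> h -` {y}. pmf (Q n) x) = pmf (map_pmf h (Q n)) y"
    using S(2) by eventually_elim (rule pmf_map_sum[OF S(1), symmetric])
  with lim_sum show ?thesis by (rule Lim_transform_eventually)
qed

text \<open>The common finite support keeps mass from escaping, so the pointwise limits still sum to
  1.\<close>

lemma pmf_limit_exists:
  fixes Q :: "nat \<Rightarrow> 'a pmf"
  assumes S: "finite S" "\<forall>\<^sub>F n in sequentially. set_pmf (Q n) \<subseteq> S"
    and conv: "\<And>x. convergent (\<lambda>n. pmf (Q n) x)"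
  obtains \<nu> where "\<And>x. (\<lambda>n. pmf (Q n) x) \<longlonglongrightarrow> pmf \<nu> x" "set_pmf \<nu> \<subseteq> S"
proof -
  define p where "p x = lim (\<lambda>n. pmf (Q n) x)" for x
  have p: "(\<lambda>n. pmf (Q n) x) \<longlonglongrightarrow> p x" for x
    using conv[of x] by (simp add: p_def convergent_LIMSEQ_iff)
  have nonneg: "0 \<le> p x" for x
    by (rule LIMSEQ_le_const[OF p]) simp
  have outside: "p x = 0" if "x \<notin> S" for x
  proof -
    have "\<forall>\<^sub>F n in sequentially. pmf (Q n) x = 0"
      using S(2) by eventually_elim (use that in \<open>auto simp: pmf_eq_0_set_pmf\<close>)
    from LIMSEQ_unique[OF p tendsto_eventually[OF this]] show ?thesis .
  qed
  have "(\<lambda>n. \<Sum>x\<in>S. pmf (Q n) x) \<longlonglongrightarrow> (\<Sum>x\<in>S. p x)"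
    by (intro tendsto_sum p)
  moreover have "\<forall>\<^sub>F n in sequentially. (\<Sum>x\<in>S. pmf (Q n) x) = 1"
    using S(2) by eventually_elim (rule sum_pmf_eq_1[OF S(1)])
  ultimately have sum1: "(\<Sum>x\<in>S. p x) = 1"
    by (rule LIMSEQ_unique[OF _ tendsto_eventually])
  have "(\<integral>\<^sup>+ x. ennreal (p x) \<partial>count_space UNIV) = (\<Sum>x\<in>S. ennreal (p x))"
    using S(1) outside by (intro nn_integral_count_space') auto
  also have "\<dots> = 1"
    using sum1 nonneg by simp
  finally have pmf: "pmf (embed_pmf p) x = p x" for x
    using nonneg by (intro pmf_embed_pmf)
  show ?thesis
  proof
    show "(\<lambda>n. pmf (Q n) x) \<longlonglongrightarrow> pmf (embed_pmf p) x" for x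
      using p by (simp add: pmf)
    show "set_pmf (embed_pmf p) \<subseteq> S"
      by (metis outside pmf set_pmf_iff subsetI)
  qed
qed

text \<open>Kolmogorov extension for laws on growing initial segments: the marginals are moved to
  real coordinates, and the projective limit taken there is decoded coordinatewise.\<close>

lemma extension_of_consistent_pmfs:
  fixes \<nu> :: "nat \<Rightarrow> (nat \<Rightarrow> 'a::countable) pmf"
  assumes consistent: "\<And>r. map_pmf (\<lambda>g. restrict g {0..r}) (\<nu> (Suc r)) = \<nu> r"
  obtains M where "prob_space M" "sets M = sets (\<Pi>\<^sub>M i\<in>UNIV. count_space UNIV)"
    "\<And>r f. f \<in> extensional {0..r} \<Longrightarrow>
      measure M {g \<in> space M. restrict g {0..r} = f} = pmf (\<nu> r) f"
proof -
  \<comment> \<open>The extension theorem needs coordinates in a Polish space, so values are encoded as reals.\<close>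
  define code :: "nat set \<Rightarrow> (nat \<Rightarrow> 'a) \<Rightarrow> nat \<Rightarrow> real"
    where "code J g = (\<lambda>i\<in>J. real (to_nat (g i)))" for J g
  define dec :: "real \<Rightarrow> 'a" where "dec x = from_nat (nat \<lfloor>x\<rfloor>)" for x
  define decode :: "(nat \<Rightarrow> real) \<Rightarrow> nat \<Rightarrow> 'a" where "decode \<omega> = (\<lambda>i. dec (\<omega> i))" for \<omega>
  have dec_of_nat [simp]: "dec (real (to_nat x)) = x" for x
    by (simp add: dec_def)
  have dec_meas [measurable]: "dec \<in> measurable borel (count_space UNIV)"
    unfolding dec_def by (rule measurable_compose[OF measurable_real_floor]) simp
  have code_meas [measurable]: "code J \<in> measurable (measure_pmf p) (PiM J (\<lambda>_. borel))" for J p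
    by (auto simp: code_def space_PiM)
  have restr: "map_pmf (\<lambda>g. restrict g {0..r}) (\<nu> (r + k)) = \<nu> r" for r k
  proof (induction k)
    case 0
    \<comment> \<open>\<open>\<nu> r\<close> is itself an image under restriction to
      \<open>{0..r}\<close>, so restricting it once more changes nothing.\<close>
    have "map_pmf (\<lambda>g. restrict g {0..r}) (\<nu> r)
        = map_pmf (\<lambda>g. restrict g {0..r}) (map_pmf (\<lambda>g. restrict g {0..r}) (\<nu> (Suc r)))"
      by (simp only: consistent)
    also have "\<dots> = \<nu> r"
      by (subst pmf.map_comp) (simp only: o_def restrict_restrict Int_absorb consistent)
    finally show ?case by (simp only: add_0_right)
  next
    case (Suc k)
    have "map_pmf (\<lambda>g. restrict g {0..r}) (\<nu> (r + k))
        = map_pmf (\<lambda>g. restrict g {0..r}) (map_pmf (\<lambda>g. restrict g {0..r + k}) (\<nu> (Suc (r + k))))"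
      by (simp only: consistent)
    also have "\<dots> = map_pmf (\<lambda>g. restrict g {0..r}) (\<nu> (r + Suc k))"
      by (subst pmf.map_comp) (simp add: o_def restrict_restrict Int_absorb1)
    finally show ?case using Suc.IH by (rule trans[OF sym])
  qed
  \<comment> \<open>\<open>insert 0\<close> gives the maximum a value for empty
    \<open>J\<close>.\<close>
  define P where "P J = distr (measure_pmf (\<nu> (Max (insert 0 J)))) (PiM J (\<lambda>_. borel)) (code J)" for J
  \<comment> \<open>Every segment containing \<open>J\<close> yields the same marginal, so the
    marginals of nested index sets can be compared on one segment.\<close>
  have P_ge: "P J = distr (measure_pmf (\<nu> r)) (PiM J (\<lambda>_. borel)) (code J)"
    if "J \<subseteq> {0..r}" for J r
  proof -
    define m where "m = Max (insert 0 J)"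
    have fin: "finite J" using that finite_subset by blast
    have mr: "m \<le> r" using that fin by (auto simp: m_def)
    have Jm: "J \<subseteq> {0..m}" using fin by (auto simp: m_def)
    have "P J = distr (measure_pmf (map_pmf (\<lambda>g. restrict g {0..m}) (\<nu> r))) (PiM J (\<lambda>_. borel)) (code J)"
      using restr[of m "r - m"] mr by (simp only: P_def m_def le_add_diff_inverse)
    also have "\<dots> = distr (measure_pmf (\<nu> r)) (PiM J (\<lambda>_. borel)) (code J \<circ> (\<lambda>g. restrict g {0..m}))"
      unfolding map_pmf_rep_eq by (subst distr_distr) (auto simp: code_def space_PiM)
    also have "code J \<circ> (\<lambda>g. restrict g {0..m}) = code J"
      using Jm by (auto simp: code_def fun_eq_iff restrict_def)
    finally show ?thesis .
  qed
  interpret polish_projective UNIV P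
  proof (intro polish_projective.intro projective_family.intro)
    fix J H :: "nat set" assume JH: "J \<subseteq> H" "finite H"
    then obtain r where r: "H \<subseteq> {0..r}"
      using finite_nat_set_iff_bounded_le[of H] by (metis atLeastAtMost_iff le0 subsetI)
    have "distr (P H) (PiM J (\<lambda>_. borel)) (\<lambda>f. restrict f J)
        = distr (measure_pmf (\<nu> r)) (PiM J (\<lambda>_. borel)) ((\<lambda>f. restrict f J) \<circ> code H)"
      unfolding P_ge[OF r] using JH by (subst distr_distr) (auto simp: code_def space_PiM intro!: measurable_restrict_subset)
    also have "(\<lambda>f. restrict f J) \<circ> code H = code J"
      using JH by (auto simp: code_def fun_eq_iff restrict_def)
    finally show "P J = distr (P H) (PiM J (\<lambda>_. borel)) (\<lambda>f. restrict f J)"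
      using P_ge[of J r] JH r by (metis subset_trans)
  next
    fix J :: "nat set"
    show "prob_space (P J)"
      unfolding P_def by (intro prob_space.prob_space_distr prob_space_measure_pmf code_meas)
  qed
  define M where "M = distr lim (\<Pi>\<^sub>M i\<in>UNIV. count_space UNIV) decode"
  have decode_meas [measurable]: "decode \<in> measurable lim (\<Pi>\<^sub>M i\<in>UNIV. count_space UNIV)"
  proof -
    have "(\<lambda>\<omega>. \<omega> i) \<in> measurable lim (borel :: real measure)" for i
      by (subst measurable_cong_sets[OF sets_lim refl]) (rule measurable_component_singleton, simp)
    from measurable_compose[OF this dec_meas] show ?thesis
      unfolding decode_def by (intro measurable_PiM_single') auto
  qed
  have coord_meas [measurable]:
    "(\<lambda>g. g i) \<in> measurable (\<Pi>\<^sub>M i\<in>UNIV. count_space (UNIV :: 'a set)) (count_space UNIV)" for i :: nat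
    by (rule measurable_component_singleton) simp
  have "measure M {g \<in> space M. restrict g {0..r} = f} = pmf (\<nu> r) f"
    if f: "f \<in> extensional {0..r}" for r f
  proof -
    let ?J = "{0..r}"
    \<comment> \<open>Testing the values after decoding makes the preimage of the cylinder under
      \<open>decode\<close> exactly the embedding of \<open>X\<close>, real sequences that are no
      codes included.\<close>
    define X where "X = {\<omega> \<in> space (PiM ?J (\<lambda>_. borel :: real measure)). \<forall>i\<in>?J. dec (\<omega> i) = f i}"
    have X: "X \<in> sets (PiM ?J (\<lambda>_. borel))"
      unfolding X_def by measurable
    have eq: "restrict g ?J = f \<longleftrightarrow> (\<forall>i\<in>?J. g i = f i)" for g
      using f by (auto simp: fun_eq_iff restrict_def extensional_def)
    have "{g \<in> space (\<Pi>\<^sub>M i\<in>UNIV. count_space UNIV). \<forall>i\<in>?J. g i = f i}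
        \<in> sets (\<Pi>\<^sub>M i\<in>UNIV. count_space UNIV)"
      by measurable
    then have "{g \<in> space M. restrict g ?J = f} \<in> sets M"
      by (simp add: eq M_def)
    then have "measure M {g \<in> space M. restrict g ?J = f}
        = measure lim (decode -` {g \<in> space M. restrict g ?J = f} \<inter> space lim)"
      unfolding M_def by (subst measure_distr) auto
    also have "decode -` {g \<in> space M. restrict g ?J = f} \<inter> space lim = emb UNIV ?J X"
      by (auto simp: X_def prod_emb_def decode_def eq M_def space_PiM)
    also have "measure lim \<dots> = measure (P ?J) X"
      using X by (intro measure_lim_emb) auto
    also have "\<dots> = measure (measure_pmf (\<nu> r)) (code ?J -` X)"
      unfolding P_ge[OF order_refl] using X by (subst measure_distr[OF code_meas]) auto
    also have "code ?J -` X = {g. restrict g ?J = f}"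
      unfolding eq by (auto simp: X_def code_def space_PiM)
    also have "measure (measure_pmf (\<nu> r)) \<dots> = pmf (map_pmf (\<lambda>g. restrict g ?J) (\<nu> r)) f"
      by (simp add: pmf_map vimage_def)
    also have "\<dots> = pmf (\<nu> r) f"
      using restr[of r 0] by (simp only: add_0_right)
    finally show ?thesis .
  qed
  moreover have "prob_space M"
    unfolding M_def by (rule P.prob_space_distr) measurable
  moreover have "sets M = sets (\<Pi>\<^sub>M i\<in>UNIV. count_space UNIV)"
    by (simp add: M_def)
  ultimately show ?thesis using that by blast
qed

section \<open>Increment words of homomorphisms\<close>

text \<open>
  For the increment word of \<open>g\<close> the sum of a factor is the difference of two values of \<open>g\<close>.
\<close>

definition step_words :: "nat \<Rightarrow> int list set" where
  "step_words d = {es. \<forall>us zs vs. es = us @ zs @ vs \<longrightarrow> odd (length zs) \<longrightarrow>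
     length zs \<le> 2 * d + 1 \<longrightarrow> \<bar>sum_list zs\<bar> = 1}"

primrec alt :: "nat \<Rightarrow> int \<Rightarrow> int list" where
  "alt 0 c = []"
| "alt (Suc n) c = c # alt n (- c)"

lemma step_wordsI:
  "(\<And>us zs vs. es = us @ zs @ vs \<Longrightarrow> odd (length zs) \<Longrightarrow> length zs \<le> 2 * d + 1 \<Longrightarrow>
     \<bar>sum_list zs\<bar> = 1) \<Longrightarrow> es \<in> step_words d"
  unfolding step_words_def by blast

lemma step_wordsD:
  "us @ zs @ vs \<in> step_words d \<Longrightarrow> odd (length zs) \<Longrightarrow> length zs \<le> 2 * d + 1 \<Longrightarrow>
     \<bar>sum_list zs\<bar> = 1"
  unfolding step_words_def by blast

lemma step_words_factor:
  assumes "us @ ws @ vs \<in> step_words d"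
  shows "ws \<in> step_words d"
proof (rule step_wordsI)
  fix as zs bs
  assume "ws = as @ zs @ bs" "odd (length zs)" "length zs \<le> 2 * d + 1"
  then show "\<bar>sum_list zs\<bar> = 1"
    using assms step_wordsD[of "us @ as" zs "bs @ vs" d] by simp
qed

text \<open>A factor that meets both \<open>us\<close> and \<open>vs\<close> contains
  \<open>ws\<close> and at least two more letters, so its length is at least
  \<open>2 * d + 2\<close>. Hence every factor to be tested lies in \<open>us @ ws\<close> or in
  \<open>ws @ vs\<close>.\<close>

lemma step_words_glue:
  assumes "us @ ws \<in> step_words d" "ws @ vs \<in> step_words d" "2 * d \<le> length ws"
  shows "us @ ws @ vs \<in> step_words d"
proof (rule step_wordsI)
  fix as zs bs
  assume eq: "us @ ws @ vs = as @ zs @ bs" and odd: "odd (length zs)" and le: "length zs \<le> 2 * d + 1"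
  show "\<bar>sum_list zs\<bar> = 1"
  proof (cases "length as + length zs \<le> length us + length ws")
    case True
    have "us @ ws = take (length us + length ws) (us @ ws @ vs)" by simp
    also have "\<dots> = as @ zs @ take (length us + length ws - (length as + length zs)) bs"
      unfolding eq using True by simp
    finally show ?thesis using assms(1) step_wordsD odd le by metis
  next
    case False
    then have "length us \<le> length as" using assms(3) le by linarith
    have "ws @ vs = drop (length us) (us @ ws @ vs)" by simp
    also have "\<dots> = drop (length us) as @ zs @ bs"
      unfolding eq using \<open>length us \<le> length as\<close> by simp
    finally show ?thesis using assms(2) step_wordsD odd le by metis
  qed
qed

lemma step_words_rev:
  assumes "es \<in> step_words d"
  shows "rev es \<in> step_words d"
proof (rule step_wordsI)
  fix us zs vs
  assume eq: "rev es = us @ zs @ vs" and *: "odd (length zs)" "length zs \<le> 2 * d + 1"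
  have "es = rev vs @ rev zs @ rev us"
    using arg_cong[OF eq, of rev] by simp
  then show "\<bar>sum_list zs\<bar> = 1"
    using assms * step_wordsD[of "rev vs" "rev zs" "rev us" d] by (simp add: sum_list_rev)
qed

lemma step_words_alphabet: "es \<in> step_words d \<Longrightarrow> set es \<subseteq> {1, -1}"
proof
  fix e assume "es \<in> step_words d" "e \<in> set es"
  then obtain us vs where "us @ [e] @ vs \<in> step_words d"
    by (metis append_Cons append_Nil in_set_conv_decomp)
  from step_wordsD[OF this] show "e \<in> {1, -1}" by auto
qed

section \<open>Alternating words and extensions by them\<close>

lemma length_alt [simp]: "length (alt n c) = n"
  by (induction n arbitrary: c) auto

lemma sum_list_alt: "sum_list (alt n c) = (if even n then 0 else c)"
  by (induction n arbitrary: c) auto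

lemma take_alt: "take k (alt n c) = alt (min k n) c"
  by (induction n arbitrary: c k) (auto simp: take_Cons split: nat.split)

lemma drop_alt: "drop k (alt n c) = alt (n - k) (if even k then c else - c)"
  by (induction n arbitrary: c k) (auto simp: drop_Cons split: nat.split)

lemma alt_Suc_right: "alt (Suc n) c = alt n c @ [if even n then c else - c]"
proof (induction n arbitrary: c)
  case (Suc n)
  show ?case
    by (subst alt.simps(2)) (simp only: Suc.IH[of "- c"], simp)
qed simp

lemma rev_alt: "rev (alt n c) = alt n (if even n then - c else c)"
proof (induction n)
  case (Suc n)
  then show ?case by (subst alt_Suc_right) simp
qed simp

text \<open>A factor is again a juxtaposition of two alternating words. If its length is odd,
  exactly one of the two has odd length and sums to 1 or -1, while the other sums to 0.\<close>

lemma alt_append_alt_in_step_words: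
  assumes "\<bar>c\<bar> = 1" "\<bar>c'\<bar> = 1"
  shows "alt m c @ alt n c' \<in> step_words d"
proof (rule step_wordsI)
  fix us zs vs
  assume eq: "alt m c @ alt n c' = us @ zs @ vs" and odd: "odd (length zs)"
  have zs: "zs = take (length zs) (drop (length us) (alt m c @ alt n c'))"
    unfolding eq by simp
  obtain p q e e' where zs_eq: "zs = alt p e @ alt q e'" and e: "\<bar>e\<bar> = 1" "\<bar>e'\<bar> = 1"
  proof
    \<comment> \<open>Truncated subtraction covers a factor that starts in the second word: then
      \<open>m - length us\<close> is 0 and the first piece is empty.\<close>
    show "zs = alt (min (length zs) (m - length us)) (if even (length us) then c else - c)
      @ alt (min (length zs - (m - length us)) (n - (length us - m)))
          (if even (length us - m) then c' else - c')"
      by (subst zs) (simp only: drop_append take_append drop_alt take_alt length_alt)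
  qed (use assms in auto)
  have "odd (p + q)" using odd by (simp add: zs_eq)
  then show "\<bar>sum_list zs\<bar> = 1"
    using e by (auto simp: zs_eq sum_list_alt)
qed

text \<open>A new factor longer than one letter ends in \<open>e, - e\<close>. These cancel, and
  removing them leaves an odd factor of \<open>us\<close> with the same sum.\<close>

lemma step_words_snoc:
  assumes "us @ [e] \<in> step_words d"
  shows "us @ [e, - e] \<in> step_words d"
proof (rule step_wordsI)
  fix as zs bs
  assume eq: "us @ [e, - e] = as @ zs @ bs" and odd: "odd (length zs)" and le: "length zs \<le> 2 * d + 1"
  have e: "\<bar>e\<bar> = 1" using step_wordsD[of us "[e]" "[]" d] assms by simp
  show "\<bar>sum_list zs\<bar> = 1"
  proof (cases bs rule: rev_cases)
    case (snoc bs' b)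
    have "(us @ [e]) @ [- e] = (as @ zs @ bs') @ [b]" using eq snoc by simp
    then have "us @ [e] = as @ zs @ bs'" by (simp only: append1_eq_conv)
    then show ?thesis using assms step_wordsD odd le by metis
  next
    case Nil
    obtain zs1 x where zs1: "zs = zs1 @ [x]"
      using odd by (cases zs rule: rev_cases) auto
    have "(us @ [e]) @ [- e] = (as @ zs1) @ [x]" using eq Nil zs1 by simp
    then have x: "x = - e" and eq1: "us @ [e] = as @ zs1" by (simp_all only: append1_eq_conv)
    show ?thesis
    proof (cases zs1 rule: rev_cases)
      case Nil
      then show ?thesis using e x zs1 by simp
    next
      case (snoc zs2 y)
      have "us = as @ zs2" "y = e" using eq1 snoc by auto
      then have "\<bar>sum_list zs2\<bar> = 1"
        using step_wordsD[of as zs2 "[e]" d] assms odd le by (simp add: zs1 snoc)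
      then show ?thesis using \<open>y = e\<close> x by (simp add: zs1 snoc)
    qed
  qed
qed

lemma step_words_append_alt:
  assumes "us @ [e] \<in> step_words d"
  shows "us @ [e] @ alt n (- e) \<in> step_words d"
  using assms
proof (induction n arbitrary: us e)
  case (Suc n)
  from Suc.IH[of "us @ [e]" "- e"] step_words_snoc[OF Suc.prems] show ?case by simp
qed simp

lemma step_words_extend_right:
  assumes "us \<in> step_words d"
  obtains c where "\<bar>c\<bar> = 1" "us @ alt n c \<in> step_words d"
proof (cases us rule: rev_cases)
  case Nil
  then show ?thesis
    using that[of 1] alt_append_alt_in_step_words[of 1 1 0 n d] by simp
next
  case (snoc vs e)
  then have "\<bar>- e\<bar> = 1" using step_wordsD[of vs "[e]" "[]" d] assms by simp
  then show ?thesis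
    using that[of "- e"] step_words_append_alt[of vs e d n] assms snoc by simp
qed

text \<open>Reversal preserves both \<open>step_words\<close> and alternation, so this is extension
  to the right of the reversed word.\<close>

lemma step_words_extend_left:
  assumes "vs \<in> step_words d"
  obtains c where "\<bar>c\<bar> = 1" "alt n c @ vs \<in> step_words d"
proof -
  obtain c where c: "\<bar>c\<bar> = 1" "rev vs @ alt n c \<in> step_words d"
    using step_words_extend_right[OF step_words_rev[OF assms]] .
  from step_words_rev[OF c(2)] have "rev (alt n c) @ vs \<in> step_words d" by simp
  then show ?thesis
    using that[of "if even n then - c else c"] c(1) by (simp add: rev_alt split: if_splits)
qed

text \<open>Each word is extended by an alternating block of length \<open>2 * d\<close>, just long
  enough for \<open>step_words_glue\<close>; the two blocks may be juxtaposed whatever their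
  signs.\<close>

lemma step_words_connect:
  assumes "us \<in> step_words d" "vs \<in> step_words d"
  shows "\<exists>ws. length ws = 4 * d \<and> us @ ws @ vs \<in> step_words d"
proof -
  obtain c where c: "\<bar>c\<bar> = 1" "us @ alt (2 * d) c \<in> step_words d"
    using step_words_extend_right[OF assms(1)] .
  obtain c' where c': "\<bar>c'\<bar> = 1" "alt (2 * d) c' @ vs \<in> step_words d"
    using step_words_extend_left[OF assms(2)] .
  have "us @ alt (2 * d) c @ alt (2 * d) c' \<in> step_words d"
    using step_words_glue[OF c(2) alt_append_alt_in_step_words[OF c(1) c'(1)]] by simp
  then have "(us @ alt (2 * d) c) @ alt (2 * d) c' @ vs \<in> step_words d"
    by (intro step_words_glue c'(2)) simp_all
  then show ?thesis
    by (intro exI[of _ "alt (2 * d) c @ alt (2 * d) c'"]) simp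
qed

section \<open>Homomorphisms and their increments\<close>

definition incr :: "nat \<Rightarrow> (nat \<Rightarrow> int) \<Rightarrow> int list" where
  "incr n g = map (\<lambda>i. g (Suc i) - g i) [0..<n]"

lemma length_incr [simp]: "length (incr n g) = n"
  by (simp add: incr_def)

lemma take_incr: "r \<le> n \<Longrightarrow> take r (incr n g) = incr r g"
  by (simp add: incr_def take_map)

lemma sum_list_incr:
  assumes "i + k \<le> n"
  shows "sum_list (take k (drop i (incr n g))) = g (i + k) - g i"
proof -
  have "take k (drop i (incr n g)) = map (\<lambda>i. g (Suc i) - g i) [i..<i + k]"
    using assms by (simp add: incr_def take_map drop_map)
  also have "sum_list \<dots> = g (i + k) - g i"
    by (simp add: interv_sum_list_conv_sum_set_nat sum_Suc_diff')
  finally show ?thesis .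
qed

lemma P_adj_add: "P_adj d i (i + k) \<longleftrightarrow> odd k \<and> k \<le> 2 * d + 1"
proof
  assume "P_adj d i (i + k)"
  then obtain l where "l \<le> d" "int k = 2 * int l + 1" by (auto simp: P_adj_def)
  then have "k = 2 * l + 1" by linarith
  then show "odd k \<and> k \<le> 2 * d + 1" using \<open>l \<le> d\<close> by simp
next
  assume *: "odd k \<and> k \<le> 2 * d + 1"
  then obtain l where "k = 2 * l + 1" by (auto elim: oddE)
  then show "P_adj d i (i + k)" using * by (auto simp: P_adj_def intro!: exI[of _ l])
qed

lemma P_adj_sym: "P_adj d i j \<longleftrightarrow> P_adj d j i"
  by (simp add: P_adj_def abs_minus_commute)

text \<open>The edge from \<open>i\<close> to \<open>i + k\<close> corresponds to the factor formed
  by the \<open>k\<close> increments from \<open>i\<close> on, and the lengths \<open>k\<close> that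
  occur are the odd ones up to \<open>2 * d + 1\<close>.\<close>

lemma Hom_P_iff:
  "g \<in> Hom_P n d \<longleftrightarrow> g \<in> extensional {0..n} \<and> g 0 = 0 \<and> incr n g \<in> step_words d"
proof -
  have "(\<forall>i\<in>{0..n}. \<forall>j\<in>{0..n}. P_adj d i j \<longrightarrow> \<bar>g i - g j\<bar> = 1) \<longleftrightarrow> incr n g \<in> step_words d"
    (is "?L \<longleftrightarrow> ?R")
  proof
    assume L: ?L
    show ?R
    proof (rule step_wordsI)
      fix us zs vs
      assume eq: "incr n g = us @ zs @ vs" and zs: "odd (length zs)" "length zs \<le> 2 * d + 1"
      have le: "length us + length zs \<le> n"
        using arg_cong[OF eq, of length] by simp
      have "zs = take (length zs) (drop (length us) (incr n g))"
        by (simp add: eq)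
      then have "sum_list zs = g (length us + length zs) - g (length us)"
        using sum_list_incr[OF le, of g] by simp
      moreover have "P_adj d (length us) (length us + length zs)"
        using zs by (simp add: P_adj_add)
      ultimately show "\<bar>sum_list zs\<bar> = 1"
        using L le by (auto simp: abs_minus_commute)
    qed
  next
    assume R: ?R
    have *: "\<bar>g i - g (i + k)\<bar> = 1" if "i + k \<le> n" "P_adj d i (i + k)" for i k
    proof -
      let ?zs = "take k (drop i (incr n g))"
      have "incr n g = take i (incr n g) @ ?zs @ drop k (drop i (incr n g))"
        by (simp only: append_take_drop_id)
      then have "\<bar>sum_list ?zs\<bar> = 1"
        using R that step_wordsD[of "take i (incr n g)" ?zs "drop k (drop i (incr n g))" d]
        by (simp add: P_adj_add)
      then show ?thesis using sum_list_incr[OF that(1), of g] by (simp add: abs_minus_commute)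
    qed
    show ?L
    proof (intro ballI impI)
      fix i j assume ij: "i \<in> {0..n}" "j \<in> {0..n}" "P_adj d i j"
      show "\<bar>g i - g j\<bar> = 1"
      proof (cases "i \<le> j")
        case True
        then show ?thesis using *[of i "j - i"] ij by simp
      next
        case False
        then show ?thesis using *[of j "i - j"] ij by (simp add: P_adj_sym abs_minus_commute)
      qed
    qed
  qed
  then show ?thesis by (auto simp: Hom_P_def Hom0_def PiE_def)
qed

lemma incr_cong: "(\<And>i. i \<le> n \<Longrightarrow> g i = h i) \<Longrightarrow> incr n g = incr n h"
  by (auto simp: incr_def)

lemma incr_inject:
  assumes "incr n g = incr n h" "g 0 = h 0" "i \<le> n"
  shows "g i = h i"
  using sum_list_incr[of 0 i n g] sum_list_incr[of 0 i n h] assms by simp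

text \<open>The inverse takes partial sums; the condition \<open>g 0 = 0\<close> fixes the constant
  of summation.\<close>

lemma bij_betw_incr:
  "bij_betw (incr n) (Hom_P n d) {es \<in> step_words d. length es = n}"
proof (rule bij_betw_byWitness[where f' = "\<lambda>es. \<lambda>i\<in>{0..n}. sum_list (take i es)"])
  show "\<forall>g\<in>Hom_P n d. (\<lambda>i\<in>{0..n}. sum_list (take i (incr n g))) = g"
  proof
    fix g assume g: "g \<in> Hom_P n d"
    have "sum_list (take i (incr n g)) = g i" if "i \<le> n" for i
      using sum_list_incr[of 0 i n g] that g by (simp add: Hom_P_iff)
    then show "(\<lambda>i\<in>{0..n}. sum_list (take i (incr n g))) = g"
      using g by (auto simp: Hom_P_iff fun_eq_iff restrict_def extensional_def)
  qed
  have *: "incr n (\<lambda>i\<in>{0..n}. sum_list (take i es)) = es" if "length es = n" for es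
    using that by (auto intro!: nth_equalityI simp: incr_def take_Suc_conv_app_nth)
  then show "\<forall>es\<in>{es \<in> step_words d. length es = n}.
      incr n (\<lambda>i\<in>{0..n}. sum_list (take i es)) = es" by simp
  show "incr n ` Hom_P n d \<subseteq> {es \<in> step_words d. length es = n}"
    by (auto simp: Hom_P_iff)
  show "(\<lambda>es. \<lambda>i\<in>{0..n}. sum_list (take i es)) ` {es \<in> step_words d. length es = n} \<subseteq> Hom_P n d"
    using * by (auto simp: Hom_P_iff)
qed

lemma restrict_Hom_P:
  assumes "g \<in> Hom_P n d" "r \<le> n"
  shows "restrict g {0..r} \<in> Hom_P r d"
  using assms by (auto simp: Hom_P_def Hom0_def)

section \<open>The limiting distribution\<close>

lemma step_words_language: "finite_type_language (step_words d) {1, -1} (2 * d) (4 * d)"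
proof
  show "step_words d \<subseteq> lists {1, -1}"
    using step_words_alphabet by (auto simp: lists_eq_set)
  show "\<exists>ws\<in>step_words d. length ws = n" for n
    using alt_append_alt_in_step_words[of 1 1 n 0 d] by (intro bexI[of _ "alt n 1"]) auto
qed (auto intro: step_words_factor step_words_glue step_words_connect)

text \<open>If \<open>f\<close> is extensional and starts at 0, fixing the values on
  \<open>{0..r}\<close> means fixing the first \<open>r\<close> increments, so the probability is a
  prefix frequency. Any other \<open>f\<close> has probability 0 for every \<open>n\<close>.\<close>

lemma convergent_pmf_restrict:
  "convergent (\<lambda>n. pmf (map_pmf (\<lambda>g. restrict g {0..r}) (pmf_of_set (Hom_P n d))) f)"
proof (cases "f \<in> extensional {0..r} \<and> f 0 = 0")
  case True
  interpret finite_type_language "step_words d" "{1, -1}" "2 * d" "4 * d"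
    by (rule step_words_language)
  \<comment> \<open>For \<open>n < r\<close> the two sides can differ, since \<open>g\<close> is
    \<open>undefined\<close> beyond \<open>n\<close>; the limit sees only large
    \<open>n\<close>.\<close>
  have eq: "pmf (map_pmf (\<lambda>g. restrict g {0..r}) (pmf_of_set (Hom_P n d))) f = freq (incr r f) n"
    if "r \<le> n" for n
  proof -
    have bij: "bij_betw (incr n) (Hom_P n d) (words n)"
      using bij_betw_incr by (simp add: words_def)
    have iff: "restrict g {0..r} = f \<longleftrightarrow> take r (incr n g) = incr r f" if g: "g \<in> Hom_P n d" for g
    proof
      assume "restrict g {0..r} = f"
      then have "g i = f i" if "i \<le> r" for i using that by auto
      then show "take r (incr n g) = incr r f"
        using incr_cong[of r g f] \<open>r \<le> n\<close> by (simp add: take_incr)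
    next
      assume "take r (incr n g) = incr r f"
      then have "g i = f i" if "i \<le> r" for i
        using incr_inject[of r g f i] that \<open>r \<le> n\<close> g True by (simp add: take_incr Hom_P_iff)
      then show "restrict g {0..r} = f"
        using True by (auto simp: fun_eq_iff restrict_def extensional_def)
    qed
    have inj: "inj_on (incr n) (Hom_P n d)" and img: "incr n ` Hom_P n d = words n"
      using bij by (auto simp: bij_betw_def)
    have "incr n ` {g \<in> Hom_P n d. restrict g {0..r} = f} = cyl (incr r f) n"
      unfolding cyl_def img[symmetric] using iff by auto
    then have "card (cyl (incr r f) n) = card {g \<in> Hom_P n d. restrict g {0..r} = f}"
      using card_image[OF inj_on_subset[OF inj], of "{g \<in> Hom_P n d. restrict g {0..r} = f}"] by auto
    moreover have "card (words n) = card (Hom_P n d)"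
      using bij by (simp add: bij_betw_same_card)
    moreover have "Hom_P n d \<inter> (\<lambda>g. restrict g {0..r}) -` {f} = {g \<in> Hom_P n d. restrict g {0..r} = f}"
      by auto
    ultimately show ?thesis
      by (simp only: pmf_map measure_pmf_of_set[OF Hom_P_nonempty finite_Hom_P] freq_def)
  qed
  have "\<forall>\<^sub>F n in sequentially. freq (incr r f) n =
      pmf (map_pmf (\<lambda>g. restrict g {0..r}) (pmf_of_set (Hom_P n d))) f"
    using eventually_ge_at_top[of r] by eventually_elim (simp add: eq)
  then show ?thesis
    using freq_convergent[of "incr r f"] by (auto simp: convergent_def intro: Lim_transform_eventually)
next
  case False
  have "pmf (map_pmf (\<lambda>g. restrict g {0..r}) (pmf_of_set (Hom_P n d))) f = 0" for n
    using False by (auto simp: pmf_eq_0_set_pmf finite_Hom_P Hom_P_nonempty Hom_P_iff)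
  then show ?thesis by (simp add: convergent_const)
qed

lemma consistent_limits:
  obtains \<nu> where
    "\<And>r f. (\<lambda>n. pmf (map_pmf (\<lambda>g. restrict g {0..r}) (pmf_of_set (Hom_P n d))) f)
      \<longlonglongrightarrow> pmf (\<nu> r) f"
    "\<And>r. set_pmf (\<nu> r) \<subseteq> Hom_P r d"
    "\<And>r. map_pmf (\<lambda>g. restrict g {0..r}) (\<nu> (Suc r)) = \<nu> r"
proof -
  define Q where "Q r n = map_pmf (\<lambda>g. restrict g {0..r}) (pmf_of_set (Hom_P n d))" for r n
  have supp: "\<forall>\<^sub>F n in sequentially. set_pmf (Q r n) \<subseteq> Hom_P r d" for r
    using eventually_ge_at_top[of r]
    by eventually_elim (auto simp: Q_def finite_Hom_P Hom_P_nonempty intro: restrict_Hom_P)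
  have "\<exists>\<nu>. (\<forall>f. (\<lambda>n. pmf (Q r n) f) \<longlonglongrightarrow> pmf \<nu> f) \<and> set_pmf \<nu> \<subseteq> Hom_P r d" for r
  proof -
    have "convergent (\<lambda>n. pmf (Q r n) f)" for f
      unfolding Q_def by (rule convergent_pmf_restrict)
    from pmf_limit_exists[OF finite_Hom_P supp this] show ?thesis by blast
  qed
  then obtain \<nu> where lim: "\<And>r f. (\<lambda>n. pmf (Q r n) f) \<longlonglongrightarrow> pmf (\<nu> r) f"
    and \<nu>: "\<And>r. set_pmf (\<nu> r) \<subseteq> Hom_P r d"
    by metis
  have "map_pmf (\<lambda>g. restrict g {0..r}) (\<nu> (Suc r)) = \<nu> r" for r
  proof (rule pmf_eqI)
    fix f
    \<comment> \<open>Consistency holds exactly for every \<open>n\<close> and is inherited by the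
      limits.\<close>
    have "map_pmf (\<lambda>g. restrict g {0..r}) (Q (Suc r) n) = Q r n" for n
      unfolding Q_def pmf.map_comp o_def by (simp add: Int_absorb1)
    then have "(\<lambda>n. pmf (Q r n) f) \<longlonglongrightarrow> pmf (map_pmf (\<lambda>g. restrict g {0..r}) (\<nu> (Suc r))) f"
      using tendsto_pmf_map[where h = "\<lambda>g. restrict g {0..r}" and y = f,
          OF finite_Hom_P supp \<nu> lim, of "Suc r"]
      by (simp only:)
    then show "pmf (map_pmf (\<lambda>g. restrict g {0..r}) (\<nu> (Suc r))) f = pmf (\<nu> r) f"
      using lim by (rule LIMSEQ_unique)
  qed
  then show ?thesis using that lim \<nu> unfolding Q_def by blast
qed

text \<open>Every edge lies in a finite window. This makes the infinite homomorphisms a countable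
  intersection of events about finitely many coordinates.\<close>

lemma Hom_P_inf_iff: "g \<in> Hom_P_inf d \<longleftrightarrow> (\<forall>r. restrict g {0..r} \<in> Hom_P r d)"
proof
  assume "g \<in> Hom_P_inf d"
  then show "\<forall>r. restrict g {0..r} \<in> Hom_P r d"
    by (auto simp: Hom_P_inf_def Hom_P_def Hom0_def)
next
  assume *: "\<forall>r. restrict g {0..r} \<in> Hom_P r d"
  have "\<bar>g i - g j\<bar> = 1" if "P_adj d i j" for i j
    using *[rule_format, of "max i j"] that by (auto simp: Hom_P_def Hom0_def)
  moreover have "g 0 = 0"
    using *[rule_format, of 0] by (simp add: Hom_P_def Hom0_def)
  ultimately show "g \<in> Hom_P_inf d"
    by (auto simp: Hom_P_inf_def Hom0_def)
qed

theorem theorem2p11: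
  fixes d :: nat
  assumes "d \<ge> 1"
  shows "\<exists>\<mu> :: (nat \<Rightarrow> int) measure.
           prob_space \<mu> \<and> sets \<mu> = sets (Hom_P_inf_space d) \<and>
           (\<forall>r :: nat. \<forall>f \<in> {0..r} \<rightarrow>\<^sub>E (UNIV :: int set).
              (\<lambda>n. measure_pmf.prob (pmf_of_set (Hom_P n d)) {g. restrict g {0..r} = f})
                \<longlonglongrightarrow> measure \<mu> {g \<in> space \<mu>. restrict g {0..r} = f})"
proof -
  obtain \<nu> where lim: "\<And>r f. (\<lambda>n. pmf (map_pmf (\<lambda>g. restrict g {0..r}) (pmf_of_set (Hom_P n d))) f)
      \<longlonglongrightarrow> pmf (\<nu> r) f"
    and supp: "\<And>r. set_pmf (\<nu> r) \<subseteq> Hom_P r d"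
    and consistent: "\<And>r. map_pmf (\<lambda>g. restrict g {0..r}) (\<nu> (Suc r)) = \<nu> r"
    using consistent_limits[of d] by blast
  obtain M where "prob_space M" and sets_M: "sets M = sets (\<Pi>\<^sub>M i\<in>UNIV. count_space (UNIV :: int set))"
    and cyl_M: "\<And>r f. f \<in> extensional {0..r} \<Longrightarrow>
      measure M {g \<in> space M. restrict g {0..r} = f} = pmf (\<nu> r) f"
    using extension_of_consistent_pmfs[OF consistent] by blast
  interpret prob_space M by fact
  have space_M [simp]: "space M = UNIV"
    using sets_eq_imp_space_eq[OF sets_M] by (simp add: space_PiM)
  have coord_meas [measurable]: "(\<lambda>g. g i) \<in> measurable M (count_space UNIV)" for i
    by (subst measurable_cong_sets[OF sets_M refl]) (rule measurable_component_singleton, simp)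
  have cyl_sets: "{g. restrict g {0..r} = f} \<in> sets M" if "f \<in> extensional {0..r}" for r f
  proof -
    have "{g \<in> space M. \<forall>i\<in>{0..r}. g i = f i} \<in> sets M" by measurable
    also have "{g \<in> space M. \<forall>i\<in>{0..r}. g i = f i} = {g. restrict g {0..r} = f}"
      using that by (auto simp: fun_eq_iff restrict_def extensional_def)
    finally show ?thesis .
  qed
  have ext: "f \<in> extensional {0..r}" if "f \<in> Hom_P r d" for r f
    using that by (simp add: Hom_P_iff)
  have Hom_r_eq: "{g. restrict g {0..r} \<in> Hom_P r d} = (\<Union>f\<in>Hom_P r d. {g. restrict g {0..r} = f})" for r
    by auto
  have Hom_r_sets: "{g. restrict g {0..r} \<in> Hom_P r d} \<in> sets M" for r
    unfolding Hom_r_eq by (intro sets.finite_UN finite_Hom_P cyl_sets ext)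
  have "AE g in M. restrict g {0..r} \<in> Hom_P r d" for r
  proof -
    \<comment> \<open>The window event is a finite disjoint union of cylinders, whose probabilities
      exhaust the mass of \<open>\<nu> r\<close>.\<close>
    have "prob {g. restrict g {0..r} \<in> Hom_P r d} = (\<Sum>f\<in>Hom_P r d. prob {g. restrict g {0..r} = f})"
      unfolding Hom_r_eq
      by (rule finite_measure_finite_Union)
        (auto simp: finite_Hom_P disjoint_family_on_def intro: cyl_sets ext)
    also have "\<dots> = (\<Sum>f\<in>Hom_P r d. pmf (\<nu> r) f)"
      using cyl_M ext by (intro sum.cong) auto
    also have "\<dots> = 1"
      by (rule sum_pmf_eq_1[OF finite_Hom_P supp])
    finally show ?thesis
      using Hom_r_sets[of r] prob_Collect_eq_1[of "\<lambda>g. restrict g {0..r} \<in> Hom_P r d"] by simp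
  qed
  then have AE_inf: "AE g in M. g \<in> Hom_P_inf d"
    unfolding Hom_P_inf_iff by (simp add: AE_all_countable)
  have "Hom_P_inf d = (\<Inter>r. {g. restrict g {0..r} \<in> Hom_P r d})"
    by (auto simp: Hom_P_inf_iff)
  then have inf_sets: "Hom_P_inf d \<in> sets M"
    using Hom_r_sets by auto
  \<comment> \<open>\<open>M\<close> lives on all integer sequences; as almost all of them are
    homomorphisms, restricting it to those leaves a probability measure.\<close>
  define \<mu> where "\<mu> = restrict_space M (Hom_P_inf d)"
  have "prob_space \<mu>"
    unfolding \<mu>_def using AE_inf inf_sets
    by (intro prob_space_restrict_space) (auto simp: emeasure_eq_1_AE)
  moreover have "sets \<mu> = sets (Hom_P_inf_space d)"
    unfolding \<mu>_def Hom_P_inf_space_def by (intro sets_restrict_space_cong sets_M)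
  moreover have "measure \<mu> {g \<in> space \<mu>. restrict g {0..r} = f} = pmf (\<nu> r) f"
    if f: "f \<in> extensional {0..r}" for r f
  proof -
    have "measure \<mu> {g \<in> space \<mu>. restrict g {0..r} = f}
        = prob (Hom_P_inf d \<inter> {g. restrict g {0..r} = f})"
      unfolding \<mu>_def using inf_sets
      by (subst measure_restrict_space) (auto simp: space_restrict_space Int_def)
    \<comment> \<open>Intersecting with an almost sure event does not change the probability of the
      cylinder.\<close>
    also have "\<dots> = prob {g. restrict g {0..r} = f}"
      using AE_inf inf_sets cyl_sets[OF f] by (intro finite_measure_eq_AE) auto
    also have "\<dots> = pmf (\<nu> r) f"
      using cyl_M[OF f] by simp
    finally show ?thesis .
  qed
  moreover have "measure_pmf.prob (pmf_of_set (Hom_P n d)) {g. restrict g {0..r} = f}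
      = pmf (map_pmf (\<lambda>g. restrict g {0..r}) (pmf_of_set (Hom_P n d))) f" for n r f
    by (simp add: pmf_map vimage_def)
  ultimately show ?thesis
    using lim by (intro exI[of _ \<mu>]) (auto simp: PiE_def)
qed

end
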